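(* Let $a,b,c,d\in\mathbb{R}$ and let $\phi:(\mathbb{R}^2,e^{-2y}dx^2+dy^2)\to(\mathbb{R}^2,e^{-2v}du^2+dv^2)$ be the linear map $\phi(x,y)=(ax+by,cx+dy)$ (a map between hyperbolic planes $H^2$). Then $\phi$ is biharmonic if and only if $a=b=0$, or $a=\pm1$, $b=c=0$, $d=1$. Furthermore, for $a=b=0$ and $d\neq0$, the map $\phi$ is a proper biharmonic map.
   Context: For a smooth map $\phi:(M,g)\to(N,h)$ between Riemannian manifolds the tension field is $\tau(\phi)=\mathrm{Trace}_g\nabla d\phi$; $\phi$ is harmonic if $\tau(\phi)=0$. It is biharmonic if it is a critical point of $\frac12\int_\Omega|\tau(\phi)|^2v_g$ for every compact $\Omega\subset M$, equivalently if $$\tau^2(\phi)=\mathrm{Trace}_g\big(\nabla^\phi\nabla^\phi-\nabla^\phi_{\nabla^M}\big)\tau(\phi)-\mathrm{Trace}_g R^N(d\phi,\tau(\phi))\,d\phi=0,$$ with $R^N(X,Y)Z=[\nabla^N_X,\nabla^N_Y]Z-\nabla^N_{[X,Y]}Z$. A biharmonic map is proper if it is not harmonic. The target coordinates are $(u,v)$, so $\phi$ is $u=ax+by$, $v=cx+dy$. *)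

theory Defs
  imports "HOL-Analysis.Analysis"
begin

text \<open>
  Riemannian geometry on manifolds covered by one global chart. A point of a manifold is its
  coordinate vector in \<open>real ^ 'n\<close>, a metric is its matrix-valued function of components
  \<open>g p $ i $ j\<close>, and tangent vectors and vector fields are given by their components in the
  coordinate frame \<open>axis i 1\<close>. All notions are intended for smooth metrics, maps and fields.
\<close>

type_synonym 'n metric = "real ^ 'n \<Rightarrow> real ^ 'n ^ 'n"

abbreviation dir_deriv ::
  "(real ^ 'm::finite \<Rightarrow> 'b::real_normed_vector) \<Rightarrow> real ^ 'm \<Rightarrow> real ^ 'm \<Rightarrow> 'b" where
  "dir_deriv F p v \<equiv> frechet_derivative F (at p) v"

definition metric_inverse :: "'n::finite metric \<Rightarrow> 'n metric" where
  "metric_inverse g p = matrix_inv (g p)"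

definition christoffel :: "'n::finite metric \<Rightarrow> real ^ 'n \<Rightarrow> 'n \<Rightarrow> 'n \<Rightarrow> 'n \<Rightarrow> real" where
  "christoffel g p k i j =
     (1/2) * (\<Sum>l\<in>UNIV. metric_inverse g p $ k $ l *
        (dir_deriv (\<lambda>q. g q $ j $ l) p (axis i 1) +
         dir_deriv (\<lambda>q. g q $ i $ l) p (axis j 1) -
         dir_deriv (\<lambda>q. g q $ i $ j) p (axis l 1)))"

text \<open>The vector with components \<open>\<Gamma>\<^sup>k\<^sub>i\<^sub>j(p) v\<^sup>i w\<^sup>j\<close>.\<close>

definition connection_form ::
  "'n::finite metric \<Rightarrow> real ^ 'n \<Rightarrow> real ^ 'n \<Rightarrow> real ^ 'n \<Rightarrow> real ^ 'n" where
  "connection_form g p v w =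
     (\<chi> k. \<Sum>i\<in>UNIV. \<Sum>j\<in>UNIV. christoffel g p k i j * v $ i * w $ j)"

definition levi_civita ::
  "'n::finite metric \<Rightarrow> (real ^ 'n \<Rightarrow> real ^ 'n) \<Rightarrow> (real ^ 'n \<Rightarrow> real ^ 'n) \<Rightarrow> real ^ 'n \<Rightarrow> real ^ 'n" where
  "levi_civita g X Y p = dir_deriv Y p (X p) + connection_form g p (X p) (Y p)"

definition lie_bracket ::
  "(real ^ 'n::finite \<Rightarrow> real ^ 'n) \<Rightarrow> (real ^ 'n \<Rightarrow> real ^ 'n) \<Rightarrow> real ^ 'n \<Rightarrow> real ^ 'n" where
  "lie_bracket X Y p = dir_deriv Y p (X p) - dir_deriv X p (Y p)"

definition curvature_operator ::
  "'n::finite metric \<Rightarrow> (real ^ 'n \<Rightarrow> real ^ 'n) \<Rightarrow> (real ^ 'n \<Rightarrow> real ^ 'n) \<Rightarrow>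
   (real ^ 'n \<Rightarrow> real ^ 'n) \<Rightarrow> real ^ 'n \<Rightarrow> real ^ 'n" where
  "curvature_operator g X Y Z p =
     levi_civita g X (levi_civita g Y Z) p - levi_civita g Y (levi_civita g X Z) p
       - levi_civita g (lie_bracket X Y) Z p"

text \<open>
  Since the curvature operator is tensorial, its value on tangent vectors at \<open>p\<close> may be computed
  from any extensions to vector fields; we take those with constant components.
\<close>

definition curvature ::
  "'n::finite metric \<Rightarrow> real ^ 'n \<Rightarrow> real ^ 'n \<Rightarrow> real ^ 'n \<Rightarrow> real ^ 'n \<Rightarrow> real ^ 'n" where
  "curvature g p x y z = curvature_operator g (\<lambda>_. x) (\<lambda>_. y) (\<lambda>_. z) p"

text \<open>
  The pull-back connection \<open>\<nabla>\<^sup>\<phi>\<^sub>X V\<close> of the Levi-Civita connection of the target metric \<open>h\<close>.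
  Here \<open>V\<close> is a vector field along \<open>\<phi>\<close>: \<open>V p\<close> is tangent to the target at \<open>\<phi> p\<close>.
\<close>

definition pullback_connection ::
  "'n::finite metric \<Rightarrow> (real ^ 'm::finite \<Rightarrow> real ^ 'n) \<Rightarrow> (real ^ 'm \<Rightarrow> real ^ 'm) \<Rightarrow>
   (real ^ 'm \<Rightarrow> real ^ 'n) \<Rightarrow> real ^ 'm \<Rightarrow> real ^ 'n" where
  "pullback_connection h \<phi> X V p =
     dir_deriv V p (X p) + connection_form h (\<phi> p) (dir_deriv \<phi> p (X p)) (V p)"

definition second_fundamental_form ::
  "'m::finite metric \<Rightarrow> 'n::finite metric \<Rightarrow> (real ^ 'm \<Rightarrow> real ^ 'n) \<Rightarrow>
   (real ^ 'm \<Rightarrow> real ^ 'm) \<Rightarrow> (real ^ 'm \<Rightarrow> real ^ 'm) \<Rightarrow> real ^ 'm \<Rightarrow> real ^ 'n" where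
  "second_fundamental_form g h \<phi> X Y p =
     pullback_connection h \<phi> X (\<lambda>q. dir_deriv \<phi> q (Y q)) p - dir_deriv \<phi> p (levi_civita g X Y p)"

definition second_covariant_derivative ::
  "'m::finite metric \<Rightarrow> 'n::finite metric \<Rightarrow> (real ^ 'm \<Rightarrow> real ^ 'n) \<Rightarrow>
   (real ^ 'm \<Rightarrow> real ^ 'm) \<Rightarrow> (real ^ 'm \<Rightarrow> real ^ 'm) \<Rightarrow>
   (real ^ 'm \<Rightarrow> real ^ 'n) \<Rightarrow> real ^ 'm \<Rightarrow> real ^ 'n" where
  "second_covariant_derivative g h \<phi> X Y V p =
     pullback_connection h \<phi> X (pullback_connection h \<phi> Y V) p
       - pullback_connection h \<phi> (levi_civita g X Y) V p"

text \<open>Trace of a bilinear form \<open>B\<close> on the tangent space at \<open>p\<close>, i.e. \<open>g\<^sup>i\<^sup>j(p) B(e\<^sub>i, e\<^sub>j)\<close>.\<close>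

definition metric_trace ::
  "'m::finite metric \<Rightarrow> real ^ 'm \<Rightarrow> (real ^ 'm \<Rightarrow> real ^ 'm \<Rightarrow> 'b::real_vector) \<Rightarrow> 'b" where
  "metric_trace g p B =
     (\<Sum>i\<in>UNIV. \<Sum>j\<in>UNIV. metric_inverse g p $ i $ j *\<^sub>R B (axis i 1) (axis j 1))"

definition tension_field ::
  "'m::finite metric \<Rightarrow> 'n::finite metric \<Rightarrow> (real ^ 'm \<Rightarrow> real ^ 'n) \<Rightarrow> real ^ 'm \<Rightarrow> real ^ 'n" where
  "tension_field g h \<phi> p =
     metric_trace g p (\<lambda>v w. second_fundamental_form g h \<phi> (\<lambda>_. v) (\<lambda>_. w) p)"

definition bitension_field ::
  "'m::finite metric \<Rightarrow> 'n::finite metric \<Rightarrow> (real ^ 'm \<Rightarrow> real ^ 'n) \<Rightarrow> real ^ 'm \<Rightarrow> real ^ 'n" where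
  "bitension_field g h \<phi> p =
     metric_trace g p
       (\<lambda>v w. second_covariant_derivative g h \<phi> (\<lambda>_. v) (\<lambda>_. w) (tension_field g h \<phi>) p)
     - metric_trace g p
       (\<lambda>v w. curvature h (\<phi> p) (dir_deriv \<phi> p v) (tension_field g h \<phi> p) (dir_deriv \<phi> p w))"

definition harmonic_map ::
  "'m::finite metric \<Rightarrow> 'n::finite metric \<Rightarrow> (real ^ 'm \<Rightarrow> real ^ 'n) \<Rightarrow> bool" where
  "harmonic_map g h \<phi> \<longleftrightarrow> (\<forall>p. tension_field g h \<phi> p = 0)"

text \<open>
  Biharmonicity is the Euler-Lagrange equation of the bienergy
  \<open>\<phi> \<mapsto> 1/2 \<integral>\<^sub>\<Omega> |\<tau>(\<phi>)|\<^sup>2\<close>, \<open>\<Omega>\<close> compact.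
\<close>

definition biharmonic_map ::
  "'m::finite metric \<Rightarrow> 'n::finite metric \<Rightarrow> (real ^ 'm \<Rightarrow> real ^ 'n) \<Rightarrow> bool" where
  "biharmonic_map g h \<phi> \<longleftrightarrow> (\<forall>p. bitension_field g h \<phi> p = 0)"

definition proper_biharmonic_map ::
  "'m::finite metric \<Rightarrow> 'n::finite metric \<Rightarrow> (real ^ 'm \<Rightarrow> real ^ 'n) \<Rightarrow> bool" where
  "proper_biharmonic_map g h \<phi> \<longleftrightarrow> biharmonic_map g h \<phi> \<and> \<not> harmonic_map g h \<phi>"

text \<open>The metric \<open>e\<^bsup>-2y\<^esup> dx\<^sup>2 + dy\<^sup>2\<close> of the hyperbolic plane, with \<open>x = p $ 1\<close> and \<open>y = p $ 2\<close>.\<close>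

definition hyperbolic_metric :: "2 metric" where
  "hyperbolic_metric p =
     vector [vector [exp (- 2 * p $ 2), 0],
             vector [0, 1]]"

definition linear_plane_map ::
  "real \<Rightarrow> real \<Rightarrow> real \<Rightarrow> real \<Rightarrow> real ^ 2 \<Rightarrow> real ^ 2" where
  "linear_plane_map a b c d p = vector [a * p $ 1 + b * p $ 2, c * p $ 1 + d * p $ 2]"

end

theory Submission
  imports Defs
begin

text \<open>
  Along a linear map everything is a polynomial in the two exponentials \<open>E = e\<^sup>2\<^sup>y\<close> and
  \<open>F = e\<^bsup>-2(cx+dy)\<^esup>\<close>, whose derivatives are multiples of themselves. The tension field is
  \<open>\<tau> = (-K, P - d)\<close> with \<open>K = 2acE + b(1 + 2d)\<close> and \<open>P = (a\<^sup>2E + b\<^sup>2)F\<close>, and differentiating it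
  twice with the pull-back connection and inserting the curvature \<open>-1\<close> gives the bitension field
  in closed form (\<open>bitension_field_linear_plane_map\<close>). It remains to see when such an
  exponential polynomial vanishes identically.

  If \<open>c \<noteq> 0\<close>, then \<open>F\<close> takes every positive value on the line \<open>y = 0\<close>, where \<open>E = 1\<close>. There the
  second component is quadratic in \<open>F\<close> with leading coefficient \<open>-2(a\<^sup>2 + b\<^sup>2)\<^sup>2\<close>, so
  \<open>a = b = 0\<close>.

  If \<open>c = 0\<close>, then \<open>F = E\<^bsup>-d\<^esup>\<close>. For \<open>b \<noteq> 0\<close> the first component becomes a relation
  \<open>\<alpha>E + \<beta> = \<gamma>E\<^sup>d\<close> whose coefficients force contradictory values of \<open>d\<close>; so \<open>b = 0\<close>. The
  second component is then \<open>2P\<close> times \<open>2d\<^sup>2 - 2d + 1 - P\<close>, where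
  \<open>P = a\<^sup>2e\<^bsup>2(1-d)y\<^esup>\<close>. For \<open>a \<noteq> 0\<close> it vanishes only if \<open>P\<close> is constant, that is \<open>d = 1\<close>, and then
  \<open>a\<^sup>2 = 1\<close>.

  Conversely, \<open>a = b = 0\<close> gives \<open>K = P = 0\<close> and hence a zero bitension field, although
  \<open>\<tau> = (0, -d)\<close>; and the maps \<open>(\<plusminus>x, y)\<close> are isometries.
\<close>

section \<open>Differentiation in coordinates\<close>

lemma vector_2_eq_axis: "(vector [x, y] :: real ^ 2) = x *\<^sub>R axis 1 1 + y *\<^sub>R axis 2 1"
  by (simp add: vec_eq_iff forall_2 axis_def)

lemma has_derivative_vector_2:
  assumes "(f has_derivative f') F" "(g has_derivative g') F"
  shows "((\<lambda>q. vector [f q, g q] :: real ^ 2) has_derivative (\<lambda>v. vector [f' v, g' v])) F"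
  unfolding vector_2_eq_axis using assms by (auto intro!: derivative_eq_intros)

lemma dir_deriv_eq:
  assumes "(f has_derivative f') (at p)"
  shows "dir_deriv f p v = f' v"
  using frechet_derivative_at[OF assms] by simp

lemma dir_deriv_const: "dir_deriv (\<lambda>_. w) p v = 0"
  by (rule dir_deriv_eq) simp

lemma has_derivative_exp_affine_2:
  "((\<lambda>q :: real ^ 2. exp (k * q $ 1 + l * q $ 2)) has_derivative
     (\<lambda>v. exp (k * p $ 1 + l * p $ 2) * (k * v $ 1 + l * v $ 2))) (at p)"
  by (auto intro!: derivative_eq_intros bounded_linear_imp_has_derivative bounded_linear_vec_nth)

section \<open>Geometry of the hyperbolic plane\<close>

lemma hyperbolic_metric_inverse:
  "metric_inverse hyperbolic_metric p = vector [vector [exp (2 * p $ 2), 0], vector [0, 1]]"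
  (is "_ = ?B")
proof -
  have AB: "hyperbolic_metric p ** ?B = mat 1"
    by (simp add: hyperbolic_metric_def matrix_matrix_mult_def mat_def vec_eq_iff forall_2 sum_2
        flip: exp_add)
  have "?B ** hyperbolic_metric p = mat 1"
    using AB matrix_left_right_inverse by blast
  with AB show ?thesis
    unfolding metric_inverse_def matrix_inv_def
    by (intro some_equality) (metis matrix_mul_assoc matrix_mul_lid matrix_mul_rid)+
qed

lemma dir_deriv_hyperbolic_metric:
  "dir_deriv (\<lambda>q. hyperbolic_metric q $ i $ j) p v =
     (if i = 1 \<and> j = 1 then - 2 * v $ 2 * exp (- 2 * p $ 2) else 0)"
proof -
  have "dir_deriv (\<lambda>q :: real ^ 2. exp (- 2 * q $ 2)) p v = - 2 * v $ 2 * exp (- 2 * p $ 2)"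
    using dir_deriv_eq[OF has_derivative_exp_affine_2[of 0 "-2" p], of v] by simp
  moreover have "\<forall>i j. (\<lambda>q. hyperbolic_metric q $ i $ j) =
    (\<lambda>q. if i = 1 \<and> j = 1 then exp (- 2 * q $ 2) else if i = j then 1 else 0)"
    by (simp add: forall_2 hyperbolic_metric_def)
  ultimately show ?thesis by (cases "i = 1 \<and> j = 1") (auto simp: dir_deriv_const)
qed

text \<open>
  As \<open>\<partial>\<^sub>yg\<^sub>1\<^sub>1\<close> is the only nonzero derivative of the metric, the only nonzero Christoffel symbols are
  \<open>\<Gamma>\<^sup>1\<^sub>1\<^sub>2 = \<Gamma>\<^sup>1\<^sub>2\<^sub>1 = -1\<close> and \<open>\<Gamma>\<^sup>2\<^sub>1\<^sub>1 = e\<^bsup>-2y\<^esup>\<close>.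
\<close>

lemma hyperbolic_connection_form:
  "connection_form hyperbolic_metric p v w =
     vector [- (v $ 1 * w $ 2 + v $ 2 * w $ 1), exp (- 2 * p $ 2) * v $ 1 * w $ 1]"
  by (simp add: connection_form_def christoffel_def vec_eq_iff forall_2 sum_2
      hyperbolic_metric_inverse dir_deriv_hyperbolic_metric axis_def field_simps flip: exp_add)

lemma levi_civita_const:
  "levi_civita g (\<lambda>_. v) (\<lambda>_. w) p = connection_form g p v w"
  by (simp add: levi_civita_def dir_deriv_const)

text \<open>
  This is \<open>R(x,y)z = -(\<langle>y,z\<rangle>x - \<langle>x,z\<rangle>y)\<close>, constant sectional curvature \<open>-1\<close>. As the
  Lie bracket of fields with constant components is zero, only the derivatives of the connection
  form and its iterates contribute.
\<close>

lemma hyperbolic_curvature: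
  "curvature hyperbolic_metric p x y z =
     (x \<bullet> (hyperbolic_metric p *v z)) *\<^sub>R y - (y \<bullet> (hyperbolic_metric p *v z)) *\<^sub>R x"
proof -
  have D: "dir_deriv (levi_civita hyperbolic_metric (\<lambda>_. y) (\<lambda>_. z)) p x =
    vector [0, - 2 * x $ 2 * exp (- 2 * p $ 2) * y $ 1 * z $ 1]" for x y z
  proof -
    have "levi_civita hyperbolic_metric (\<lambda>_. y) (\<lambda>_. z) =
      (\<lambda>q. vector [- (y $ 1 * z $ 2 + y $ 2 * z $ 1), exp (0 * q $ 1 + (- 2) * q $ 2) * (y $ 1 * z $ 1)])"
      by (rule ext) (simp add: levi_civita_const hyperbolic_connection_form mult.assoc)
    moreover have "(\<dots> has_derivative (\<lambda>x. vector [0, exp (0 * p $ 1 + (- 2) * p $ 2) *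
        (0 * x $ 1 + (- 2) * x $ 2) * (y $ 1 * z $ 1)])) (at p)"
      by (intro has_derivative_vector_2 has_derivative_const has_derivative_mult_left
          has_derivative_exp_affine_2)
    ultimately show ?thesis
      by (simp add: dir_deriv_eq mult_ac)
  qed
  show ?thesis
    unfolding curvature_def curvature_operator_def
      levi_civita_def[of _ _ "levi_civita _ _ _"] D
    by (simp add: levi_civita_def lie_bracket_def dir_deriv_const hyperbolic_connection_form
        hyperbolic_metric_def vec_eq_iff forall_2 matrix_vector_mult_def sum_2 inner_vec_def
        algebra_simps)
qed

section \<open>Tension and bitension of a linear map\<close>

lemma linear_plane_map_nth [simp]:
  "linear_plane_map a b c d p $ 1 = a * p $ 1 + b * p $ 2"
  "linear_plane_map a b c d p $ 2 = c * p $ 1 + d * p $ 2"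
  by (simp_all add: linear_plane_map_def)

lemma dir_deriv_linear_plane_map:
  "dir_deriv (linear_plane_map a b c d) p v = linear_plane_map a b c d v"
proof (rule dir_deriv_eq)
  have "((\<lambda>q. linear_plane_map a b c d q) has_derivative linear_plane_map a b c d) (at p)"
    unfolding linear_plane_map_def
    by (intro has_derivative_vector_2 bounded_linear_imp_has_derivative bounded_linear_add
        bounded_linear_const_mult bounded_linear_vec_nth)
  then show "(linear_plane_map a b c d has_derivative linear_plane_map a b c d) (at p)" .
qed

lemma hyperbolic_metric_trace:
  "metric_trace hyperbolic_metric p B =
     exp (2 * p $ 2) *\<^sub>R B (axis 1 1) (axis 1 1) + B (axis 2 1) (axis 2 1)"
  by (simp add: metric_trace_def hyperbolic_metric_inverse sum_2)

text \<open>
  The two exponentials \<open>E\<close> and \<open>F\<close>: the factor \<open>g\<^sup>1\<^sup>1\<close> of the inverse metric on the domain, and the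
  factor \<open>h\<^sub>1\<^sub>1\<close> of the target metric at the image point. They are named because all
  further computations treat them as two unknowns with known logarithmic derivatives.
\<close>

definition domain_weight :: "real ^ 2 \<Rightarrow> real" where
  "domain_weight p = exp (2 * p $ 2)"

definition target_weight :: "real \<Rightarrow> real \<Rightarrow> real ^ 2 \<Rightarrow> real" where
  "target_weight c d p = exp (- 2 * (c * p $ 1 + d * p $ 2))"

lemma has_derivative_domain_weight [derivative_intros]:
  "(domain_weight has_derivative (\<lambda>v. 2 * v $ 2 * domain_weight p)) (at p)"
  using has_derivative_exp_affine_2[of 0 2 p] by (simp add: domain_weight_def[abs_def] mult_ac)

lemma has_derivative_target_weight [derivative_intros]:
  "(target_weight c d has_derivative (\<lambda>v. - 2 * (c * v $ 1 + d * v $ 2) * target_weight c d p)) (at p)"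
  using has_derivative_exp_affine_2[of "-2*c" "-2*d" p]
  by (simp add: target_weight_def[abs_def] algebra_simps)

lemma tension_field_linear_plane_map:
  "tension_field hyperbolic_metric hyperbolic_metric (linear_plane_map a b c d) =
     (\<lambda>p. vector [- 2 * a * c * domain_weight p - b * (1 + 2 * d),
        (a\<^sup>2 * domain_weight p + b\<^sup>2) * target_weight c d p - d])"
  by (rule ext) (simp add: tension_field_def hyperbolic_metric_trace second_fundamental_form_def pullback_connection_def
      dir_deriv_linear_plane_map dir_deriv_const levi_civita_const hyperbolic_connection_form
      vec_eq_iff forall_2 axis_def domain_weight_def target_weight_def
      algebra_simps power2_eq_square flip: exp_add)

text \<open>
  The rule by which each of the two covariant derivatives of the tension field is computed: it turns
  a field given by its two component functions into another one of that form.
\<close>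

lemma pullback_connection_linear_plane_map:
  assumes "(s has_derivative s') (at p)" "(t has_derivative t') (at p)"
  shows "pullback_connection hyperbolic_metric (linear_plane_map a b c d) X (\<lambda>q. vector [s q, t q]) p =
    vector [s' (X p) - (a * X p $ 1 + b * X p $ 2) * t p - (c * X p $ 1 + d * X p $ 2) * s p,
            t' (X p) + target_weight c d p * (a * X p $ 1 + b * X p $ 2) * s p]"
  unfolding pullback_connection_def dir_deriv_linear_plane_map
    dir_deriv_eq[OF has_derivative_vector_2[OF assms]]
  by (simp add: hyperbolic_connection_form vec_eq_iff forall_2 target_weight_def algebra_simps)

text \<open>
  The vector \<open>(-K, P - d)\<close> is the tension field, and \<open>P'\<close> and \<open>P''\<close> are the derivatives of \<open>P\<close> in
  \<open>y\<close>. Since the metric is diagonal, the trace of the second covariant derivative is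
  \<open>E \<nabla>\<^sub>x\<nabla>\<^sub>x + \<nabla>\<^sub>y\<nabla>\<^sub>y - \<nabla>\<^sub>y\<close>; the last term comes from \<open>\<nabla>\<^sub>x\<partial>\<^sub>x = E\<^sup>-\<^sup>1\<partial>\<^sub>y\<close>.
\<close>

lemma bitension_field_linear_plane_map:
  fixes a b c d :: real and p :: "real ^ 2"
  defines "E \<equiv> domain_weight p" and "F \<equiv> target_weight c d p"
  defines "K \<equiv> 2 * a * c * E + b * (1 + 2 * d)"
    and "P \<equiv> (a\<^sup>2 * E + b\<^sup>2) * F"
    and "P' \<equiv> 2 * (1 - d) * a\<^sup>2 * E * F - 2 * d * b\<^sup>2 * F"
    and "P'' \<equiv> 4 * (1 - d)\<^sup>2 * a\<^sup>2 * E * F + 4 * d\<^sup>2 * b\<^sup>2 * F"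
  shows "bitension_field hyperbolic_metric hyperbolic_metric (linear_plane_map a b c d) p =
    vector [2 * K * (P - d) + 4 * a * c * E * (P + 2 * d - 1) - 2 * b * P',
            - 2 * P * (P - d) + 4 * c\<^sup>2 * E * P + K\<^sup>2 * F - 8 * a * b * c * E * F + P'' - P']"
proof -
  let ?\<phi> = "linear_plane_map a b c d"
  let ?D = "pullback_connection hyperbolic_metric ?\<phi>"
  let ?s = "\<lambda>q. - 2 * a * c * domain_weight q - b * (1 + 2 * d)"
  let ?t = "\<lambda>q. (a\<^sup>2 * domain_weight q + b\<^sup>2) * target_weight c d q - d"
  let ?\<tau> = "\<lambda>q. vector [?s q, ?t q] :: real ^ 2"
  let ?P = "\<lambda>q. (a\<^sup>2 * domain_weight q + b\<^sup>2) * target_weight c d q"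
  have D: "?D X ?\<tau> q = vector
      [- 4 * a * c * X q $ 2 * domain_weight q
         - (a * X q $ 1 + b * X q $ 2) * ?t q - (c * X q $ 1 + d * X q $ 2) * ?s q,
       2 * a\<^sup>2 * X q $ 2 * domain_weight q * target_weight c d q
         - 2 * (c * X q $ 1 + d * X q $ 2) * ?P q
         + target_weight c d q * (a * X q $ 1 + b * X q $ 2) * ?s q]" for X q
    by (subst pullback_connection_linear_plane_map, (rule derivative_intros)+)
      (simp add: vec_eq_iff forall_2 algebra_simps)
  have D1: "?D (\<lambda>_. axis 1 1) ?\<tau> = (\<lambda>q. vector [- a * ?t q - c * ?s q,
      - 2 * c * ?P q + target_weight c d q * (a * ?s q)])"
    unfolding fun_eq_iff D by (simp add: axis_def vec_eq_iff forall_2)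
  have D2: "?D (\<lambda>_. axis 2 1) ?\<tau> = (\<lambda>q. vector
      [- 4 * a * c * domain_weight q - b * ?t q - d * ?s q,
       2 * a\<^sup>2 * domain_weight q * target_weight c d q - 2 * d * ?P q
         + target_weight c d q * (b * ?s q)])"
    unfolding fun_eq_iff D by (simp add: axis_def vec_eq_iff forall_2)
  have D11: "?D (\<lambda>_. axis 1 1) (?D (\<lambda>_. axis 1 1) ?\<tau>) p =
      vector [4 * a * c * P + a\<^sup>2 * K * F + a * c * (P - d) - c\<^sup>2 * K,
        4 * c\<^sup>2 * P + 3 * a * c * K * F - a\<^sup>2 * F * (P - d)]"
    unfolding D1
    by (subst pullback_connection_linear_plane_map, (rule derivative_intros)+)
      (simp add: vec_eq_iff forall_2 axis_def P_def K_def E_def F_def algebra_simps power2_eq_square)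
  have D22: "?D (\<lambda>_. axis 2 1) (?D (\<lambda>_. axis 2 1) ?\<tau>) p =
      vector [- 8 * a * c * E - 2 * b * P' + 8 * a * c * d * E + b\<^sup>2 * K * F + b * d * (P - d)
          - d\<^sup>2 * K,
        P'' - 8 * a * b * c * E * F + 3 * b * d * K * F - b\<^sup>2 * F * (P - d)]"
    unfolding D2
    by (subst pullback_connection_linear_plane_map, (rule derivative_intros)+)
      (simp add: vec_eq_iff forall_2 axis_def P_def P'_def P''_def K_def E_def F_def
        algebra_simps power2_eq_square)
  have E: "E * exp (- (2 * p $ 2)) = 1" "exp (2 * p $ 2) = E"
    by (simp_all add: E_def domain_weight_def flip: exp_add)
  have F: "hyperbolic_metric (?\<phi> p) = vector [vector [F, 0], vector [0, 1]]"
    by (simp add: hyperbolic_metric_def F_def target_weight_def)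
  have \<tau>: "?\<tau> p = vector [- K, P - d]"
    by (simp add: K_def P_def E_def F_def)
  have D\<Gamma>: "?D (levi_civita hyperbolic_metric (\<lambda>_. axis 1 1) (\<lambda>_. axis 1 1)) ?\<tau> p =
      exp (- (2 * p $ 2)) *\<^sub>R ?D (\<lambda>_. axis 2 1) ?\<tau> p"
     "?D (levi_civita hyperbolic_metric (\<lambda>_. axis 2 1) (\<lambda>_. axis 2 1)) ?\<tau> p = 0"
    unfolding D by (simp_all add: levi_civita_const hyperbolic_connection_form axis_def
        vec_eq_iff forall_2 algebra_simps)
  have D2p: "?D (\<lambda>_. axis 2 1) ?\<tau> p = vector [- 4 * a * c * E - b * (P - d) + d * K, P' - b * K * F]"
    unfolding D2
    by (simp add: vec_eq_iff forall_2 P_def P'_def K_def E_def F_def algebra_simps power2_eq_square)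
  have lap: "metric_trace hyperbolic_metric p
      (\<lambda>v w. second_covariant_derivative hyperbolic_metric hyperbolic_metric ?\<phi> (\<lambda>_. v) (\<lambda>_. w) ?\<tau> p) =
    E *\<^sub>R ?D (\<lambda>_. axis 1 1) (?D (\<lambda>_. axis 1 1) ?\<tau>) p - ?D (\<lambda>_. axis 2 1) ?\<tau> p
      + ?D (\<lambda>_. axis 2 1) (?D (\<lambda>_. axis 2 1) ?\<tau>) p"
    unfolding hyperbolic_metric_trace second_covariant_derivative_def D\<Gamma>
    by (simp add: scaleR_diff_right E flip: exp_add)
  have curv: "metric_trace hyperbolic_metric p
      (\<lambda>v w. curvature hyperbolic_metric (?\<phi> p) (dir_deriv ?\<phi> p v) (?\<tau> p) (dir_deriv ?\<phi> p w)) =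
    vector [- E * (a * c * (P - d) + c\<^sup>2 * K) - (b * d * (P - d) + d\<^sup>2 * K),
       E * F * (a * c * K + a\<^sup>2 * (P - d)) + F * (b * d * K + b\<^sup>2 * (P - d))]"
    unfolding \<tau> dir_deriv_linear_plane_map hyperbolic_metric_trace hyperbolic_curvature F
    by (simp add: E vec_eq_iff forall_2 axis_def
        matrix_vector_mult_def sum_2 inner_vec_def algebra_simps power2_eq_square)
  show ?thesis
    unfolding bitension_field_def tension_field_linear_plane_map lap curv D11 D22 D2p
    by (simp add: vec_eq_iff forall_2 P_def P'_def P''_def K_def algebra_simps power2_eq_square)
qed

section \<open>Vanishing of the bitension field\<close>

text \<open>
  On the line \<open>y = 0\<close> the second component equals \<open>F(k - 2(a\<^sup>2 + b\<^sup>2)\<^sup>2F)\<close> with \<open>k\<close> constant,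
  and \<open>F\<close> is an arbitrary positive number there.
\<close>

lemma biharmonic_c_nonzero_imp_constant_u:
  fixes a b c d :: real
  assumes bi: "biharmonic_map hyperbolic_metric hyperbolic_metric (linear_plane_map a b c d)"
    and c: "c \<noteq> 0"
  shows "a = 0 \<and> b = 0"
proof -
  define m where "m = a\<^sup>2 + b\<^sup>2"
  define K where "K = 2 * a * c + b * (1 + 2 * d)"
  define k where "k = 2 * m * d + 4 * c\<^sup>2 * m + K\<^sup>2 - 8 * a * b * c
    + 4 * (1 - d)\<^sup>2 * a\<^sup>2 + 4 * d\<^sup>2 * b\<^sup>2 - (2 * (1 - d) * a\<^sup>2 - 2 * d * b\<^sup>2)"
  have F: "2 * m\<^sup>2 * F = k" if "F > 0" for F
  proof -
    let ?p = "vector [- ln F / (2 * c), 0] :: real ^ 2"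
    have E1: "domain_weight ?p = 1" by (simp add: domain_weight_def)
    have F1: "target_weight c d ?p = F" using that c by (simp add: target_weight_def)
    have "bitension_field hyperbolic_metric hyperbolic_metric (linear_plane_map a b c d) ?p $ 2 = 0"
      using bi by (simp add: biharmonic_map_def)
    then have "F * (k - 2 * m\<^sup>2 * F) = 0"
      unfolding bitension_field_linear_plane_map E1 F1 k_def K_def m_def
      by (simp add: algebra_simps power2_eq_square)
    then show ?thesis using that by simp
  qed
  have "m = 0" using F[of 1] F[of 2] by simp
  then show ?thesis by (simp add: m_def sum_power2_eq_zero_iff)
qed

lemma weights_on_y_axis:
  "domain_weight (vector [0, y]) = exp (2 * y)"
  "target_weight 0 d (vector [0, y]) = exp (- 2 * d * y)"
  by (simp_all add: domain_weight_def target_weight_def)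

text \<open>
  On the line \<open>x = 0\<close>, dividing the first component by \<open>2bF\<close> leaves \<open>\<alpha>e\<^sup>2\<^sup>y + \<beta> = \<gamma>e\<^bsup>2dy\<^esup>\<close>.
  The right-hand side takes values in geometric progression at \<open>y = 0, 1/2, 1\<close>, and the left-hand
  side can do so only if \<open>\<alpha>\<beta> = 0\<close>: the relation is then between at most two exponentials. This
  avoids a case distinction on coincidences among the exponents \<open>2\<close>, \<open>0\<close> and \<open>2d\<close>.
\<close>

lemma biharmonic_c_0_imp_b_0:
  fixes a b d :: real
  assumes bi: "biharmonic_map hyperbolic_metric hyperbolic_metric (linear_plane_map a b 0 d)"
  shows "b = 0"
proof (rule ccontr)
  assume b: "b \<noteq> 0"
  define \<alpha> \<beta> \<gamma> where "\<alpha> = a\<^sup>2 * (4 * d - 1)" and "\<beta> = b\<^sup>2 * (4 * d + 1)" and "\<gamma> = d * (1 + 2 * d)"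
  have main: "\<alpha> * exp (2 * y) + \<beta> = \<gamma> * exp (2 * d * y)" for y
  proof -
    have "bitension_field hyperbolic_metric hyperbolic_metric (linear_plane_map a b 0 d) (vector [0, y]) $ 1 = 0"
      using bi by (simp add: biharmonic_map_def)
    then have "2 * b * ((\<alpha> * exp (2 * y) + \<beta>) * exp (- 2 * d * y) - \<gamma>) = 0"
      unfolding bitension_field_linear_plane_map weights_on_y_axis \<alpha>_def \<beta>_def \<gamma>_def
      by (simp add: algebra_simps power2_eq_square)
    then have "(\<alpha> * exp (2 * y) + \<beta>) * exp (- 2 * d * y) * exp (2 * d * y) = \<gamma> * exp (2 * d * y)"
      using b by simp
    then show ?thesis by (simp add: mult.assoc flip: exp_add)
  qed
  define z w where "z = exp (1::real)" and "w = exp d"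
  have z: "z > 1" by (simp add: z_def)
  have 0: "\<alpha> + \<beta> = \<gamma>" using main[of 0] by simp
  have 1: "\<alpha> * z + \<beta> = \<gamma> * w" using main[of "1/2"] by (simp add: z_def w_def)
  have 2: "\<alpha> * z\<^sup>2 + \<beta> = \<gamma> * w\<^sup>2" using main[of 1]
    by (simp add: z_def w_def mult.commute flip: exp_double)
  \<comment> \<open>The right-hand side compares the product of the outer values with the square of the middle one.\<close>
  have "\<alpha> * \<beta> * (z - 1)\<^sup>2 = (\<alpha> + \<beta>) * (\<alpha> * z\<^sup>2 + \<beta>) - (\<alpha> * z + \<beta>)\<^sup>2"
    by algebra
  also have "\<dots> = 0" unfolding 0 1 2 by algebra
  finally have "\<alpha> = 0 \<or> \<beta> = 0" using z by simp
  then show False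
  proof
    assume "\<alpha> = 0"
    then have "\<gamma> * (w - 1) = 0" using 0 1 by (simp add: algebra_simps)
    then have "\<gamma> = 0" by (auto simp: w_def \<gamma>_def)
    then have "\<beta> = 0" "\<gamma> = 0" using 0 \<open>\<alpha> = 0\<close> by auto
    then have "4 * d + 1 = 0" "d = 0 \<or> 1 + 2 * d = 0" using b by (auto simp: \<beta>_def \<gamma>_def)
    then show False by linarith
  next
    assume "\<beta> = 0"
    then have d: "d = - 1/4" using b by (simp add: \<beta>_def)
    have "\<gamma> * (w - z) = 0" using 0 1 \<open>\<beta> = 0\<close> by (auto simp: algebra_simps)
    then show False by (simp add: w_def z_def \<gamma>_def d)
  qed
qed

text \<open>
  With \<open>b = c = 0\<close> the second component factors as \<open>2P(2d\<^sup>2 - 2d + 1 - P)\<close>, so the exponential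
  \<open>P\<close> has to be constant.
\<close>

lemma biharmonic_diagonal_imp_isometry:
  fixes a d :: real
  assumes bi: "biharmonic_map hyperbolic_metric hyperbolic_metric (linear_plane_map a 0 0 d)"
    and a: "a \<noteq> 0"
  shows "a\<^sup>2 = 1 \<and> d = 1"
proof -
  have main: "a\<^sup>2 * exp (2 * (1 - d) * y) = 2 * d\<^sup>2 - 2 * d + 1" for y
  proof -
    define P where "P = a\<^sup>2 * exp (2 * (1 - d) * y)"
    have P: "a\<^sup>2 * exp (2 * y) * exp (- 2 * d * y) = P"
      by (simp add: P_def algebra_simps flip: exp_add)
    have "bitension_field hyperbolic_metric hyperbolic_metric (linear_plane_map a 0 0 d) (vector [0, y]) $ 2 = 0"
      using bi by (simp add: biharmonic_map_def)
    then have "- 2 * P * (P - d) + 4 * (1 - d)\<^sup>2 * P - 2 * (1 - d) * P = 0"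
      unfolding bitension_field_linear_plane_map weights_on_y_axis P[symmetric] by (simp add: mult_ac)
    then have "2 * P * (2 * d\<^sup>2 - 2 * d + 1 - P) = 0"
      by (simp add: algebra_simps power2_eq_square)
    moreover have "P \<noteq> 0" using a by (simp add: P_def)
    ultimately show ?thesis by (simp add: P_def)
  qed
  have "a\<^sup>2 * exp (2 * (1 - d)) = a\<^sup>2" using main[of 0] main[of 1] by simp
  then have "d = 1" using a by simp
  with main[of 0] show ?thesis by simp
qed

lemma biharmonic_constant_u:
  "biharmonic_map hyperbolic_metric hyperbolic_metric (linear_plane_map 0 0 c d)"
  by (simp add: biharmonic_map_def bitension_field_linear_plane_map vec_eq_iff forall_2)

text \<open>
  Here \<open>EF = 1\<close>, so that \<open>P = a\<^sup>2 = 1 = d\<close> and \<open>K = 0\<close>: the tension field is already zero, as for every isometry.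
\<close>

lemma biharmonic_isometry:
  assumes "a\<^sup>2 = 1"
  shows "biharmonic_map hyperbolic_metric hyperbolic_metric (linear_plane_map a 0 0 1)"
proof -
  have "domain_weight p * target_weight 0 1 p = 1" for p
    by (simp add: domain_weight_def target_weight_def flip: exp_add)
  then show ?thesis
    by (simp add: biharmonic_map_def bitension_field_linear_plane_map vec_eq_iff forall_2 assms)
qed

theorem proposition3p6:
  fixes a b c d :: real
  shows "(biharmonic_map hyperbolic_metric hyperbolic_metric (linear_plane_map a b c d) \<longleftrightarrow>
            (a = 0 \<and> b = 0) \<or> ((a = 1 \<or> a = - 1) \<and> b = 0 \<and> c = 0 \<and> d = 1))
       \<and> (a = 0 \<and> b = 0 \<and> d \<noteq> 0 \<longrightarrow>
            proper_biharmonic_map hyperbolic_metric hyperbolic_metric (linear_plane_map a b c d))"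
proof (intro conjI iffI impI)
  assume bi: "biharmonic_map hyperbolic_metric hyperbolic_metric (linear_plane_map a b c d)"
  show "(a = 0 \<and> b = 0) \<or> ((a = 1 \<or> a = - 1) \<and> b = 0 \<and> c = 0 \<and> d = 1)"
  proof (cases "c = 0")
    case True
    then have "b = 0" using bi biharmonic_c_0_imp_b_0 by simp
    then show ?thesis using bi True biharmonic_diagonal_imp_isometry[of a d] by (auto simp: power2_eq_1_iff)
  next
    case False
    then show ?thesis using bi biharmonic_c_nonzero_imp_constant_u by blast
  qed
next
  assume "(a = 0 \<and> b = 0) \<or> ((a = 1 \<or> a = - 1) \<and> b = 0 \<and> c = 0 \<and> d = 1)"
  then show "biharmonic_map hyperbolic_metric hyperbolic_metric (linear_plane_map a b c d)"
    by (auto simp: biharmonic_constant_u biharmonic_isometry)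
next
  assume "a = 0 \<and> b = 0 \<and> d \<noteq> 0"
  then show "proper_biharmonic_map hyperbolic_metric hyperbolic_metric (linear_plane_map a b c d)"
    by (simp add: proper_biharmonic_map_def biharmonic_constant_u harmonic_map_def
        tension_field_linear_plane_map vec_eq_iff forall_2)
qed

end
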